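(* Let $n\ge5$, $N\ge2$ and let $F,G:\mathbb{R}^n\times\big(\mathbb{R}^N\otimes\mathbb{S}(n)\big)\to\mathbb{R}^N$ be Carathéodory maps. Suppose that the operator $u\mapsto F(\cdot,D^2u)$ is a bijection from $W^{2,2}_\ast(\mathbb{R}^n)^N$ onto $L^2(\mathbb{R}^n)^N$ and that $$\nu(F):=\inf_{v\neq w}\frac{\big\|F(\cdot,D^2w)-F(\cdot,D^2v)\big\|_{L^2(\mathbb{R}^n)}}{\|D^2w-D^2v\|_{L^2(\mathbb{R}^n)}}>0,$$ where the infimum is over $v\ne w$ in $W^{2,2}_\ast(\mathbb{R}^n)^N$. If $G(\cdot,\mathbf{0})=0$ and $$\operatorname*{ess\,sup}_{x\in\mathbb{R}^n}\ \sup_{\mathbf{X}\ne\mathbf{Y}}\left|\frac{\big(F(x,\mathbf{Y})-F(x,\mathbf{X})\big)-\big(G(x,\mathbf{Y})-G(x,\mathbf{X})\big)}{|\mathbf{Y}-\mathbf{X}|}\right|<\nu(F),$$ where the supremum is over $\mathbf{X}\neq\mathbf{Y}$ in $\mathbb{R}^N\otimes\mathbb{S}(n)$, then for any given $g\in L^2(\mathbb{R}^n)^N$ the system $$G(\cdot,D^2u)=g\quad\text{a.e. on }\mathbb{R}^n$$ has a unique global strong a.e. solution $u$ in the space $W^{2,2}_\ast(\mathbb{R}^n)^N$.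
   Context: $\mathbb{S}(n)$ is the space of symmetric real $n\times n$ matrices; elements of $\mathbb{R}^N\otimes\mathbb{S}(n)$ are arrays $\mathbf{X}=(\mathbf{X}_{\alpha ij})$, $1\le\alpha\le N$, $1\le i,j\le n$, symmetric in $i,j$, with Euclidean norm $|\mathbf{X}|^2=\sum_{\alpha,i,j}\mathbf{X}_{\alpha ij}^2$. $D^2u=(D^2_{ij}u_\alpha)$ is the weak Hessian. Carathéodory map: $x\mapsto F(x,\mathbf{X})$ is measurable for every $\mathbf{X}$ and $\mathbf{X}\mapsto F(x,\mathbf{X})$ is continuous for a.e. $x$. With $2^*=\frac{2n}{n-2}$ and $2^{**}=\frac{2n}{n-4}$, $$W^{2,2}_\ast(\mathbb{R}^n)^N:=\big\{u\in L^{2^{**}}(\mathbb{R}^n)^N\ \big|\ Du\in L^{2^*}(\mathbb{R}^n)^{Nn},\ D^2u\in L^2(\mathbb{R}^n)^{Nn^2}\big\}$$ (weak derivatives). *)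

theory Defs
  imports "HOL-Analysis.Analysis" "HOL-Probability.Essential_Supremum"
begin

type_synonym ('N, 'n) array3 = "real^'n^'n^'N"

(* The iterated Euclidean norm on real^'n^'n^'N is the Euclidean norm of the full array. *)
definition sym_arrays :: "('N::finite, 'n::finite) array3 set" where
  "sym_arrays = {X. \<forall>\<alpha> i j. X $ \<alpha> $ i $ j = X $ \<alpha> $ j $ i}"

(* Maps on R^n x (R^N (x) S(n)) are represented by functions that are total in the second
   argument; their values outside sym_arrays are never constrained. *)
definition caratheodory ::
  "(real^'n::finite \<Rightarrow> ('N::finite, 'n) array3 \<Rightarrow> real^'N) \<Rightarrow> bool" where
  "caratheodory F \<longleftrightarrow>
     (\<forall>X\<in>sym_arrays. (\<lambda>x. F x X) \<in> borel_measurable lebesgue) \<and>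
     (AE x in lebesgue. continuous_on sym_arrays (F x))"

(* Functions, not classes modulo null sets: equality in Lp is equality almost everywhere. *)
definition Lp :: "real \<Rightarrow> (real^'n::finite \<Rightarrow> 'b::euclidean_space) set" where
  "Lp p = {f. f \<in> borel_measurable lebesgue \<and> integrable lebesgue (\<lambda>x. norm (f x) powr p)}"

definition Lp_norm :: "real \<Rightarrow> (real^'n::finite \<Rightarrow> 'b::euclidean_space) \<Rightarrow> real" where
  "Lp_norm p f = (\<integral>x. norm (f x) powr p \<partial>lebesgue) powr (1 / p)"

definition locally_integrable :: "(real^'n::finite \<Rightarrow> real) \<Rightarrow> bool" where
  "locally_integrable f \<longleftrightarrow> (\<forall>K. compact K \<longrightarrow> set_integrable lebesgue K f)"

definition partial :: "'n::finite \<Rightarrow> (real^'n \<Rightarrow> real) \<Rightarrow> real^'n \<Rightarrow> real" where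
  "partial i f x = frechet_derivative f (at x) (axis i 1)"

primrec iter_partial :: "'n::finite list \<Rightarrow> (real^'n \<Rightarrow> real) \<Rightarrow> real^'n \<Rightarrow> real" where
  "iter_partial [] f = f"
| "iter_partial (i # is) f = partial i (iter_partial is f)"

(* Differentiability of all iterated partial derivatives gives their continuity, hence C^infinity. *)
definition smooth :: "(real^'n::finite \<Rightarrow> real) \<Rightarrow> bool" where
  "smooth f \<longleftrightarrow> (\<forall>is. iter_partial is f differentiable_on UNIV)"

definition test_function :: "(real^'n::finite \<Rightarrow> real) \<Rightarrow> bool" where
  "test_function \<phi> \<longleftrightarrow> smooth \<phi> \<and> compact (closure {x. \<phi> x \<noteq> 0})"

definition has_weak_partial ::
  "'n::finite list \<Rightarrow> (real^'n \<Rightarrow> real) \<Rightarrow> (real^'n \<Rightarrow> real) \<Rightarrow> bool" where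
  "has_weak_partial is u v \<longleftrightarrow>
     locally_integrable u \<and> locally_integrable v \<and>
     (\<forall>\<phi>. test_function \<phi> \<longrightarrow>
        (\<integral>x. u x * iter_partial is \<phi> x \<partial>lebesgue)
          = (- 1) ^ length is * (\<integral>x. v x * \<phi> x \<partial>lebesgue))"

definition has_weak_gradient ::
  "(real^'n::finite \<Rightarrow> real^'N::finite) \<Rightarrow> (real^'n \<Rightarrow> real^'n^'N) \<Rightarrow> bool" where
  "has_weak_gradient u A \<longleftrightarrow>
     (\<forall>\<alpha> i. has_weak_partial [i] (\<lambda>x. u x $ \<alpha>) (\<lambda>x. A x $ \<alpha> $ i))"

definition has_weak_hessian ::
  "(real^'n::finite \<Rightarrow> real^'N::finite) \<Rightarrow> (real^'n \<Rightarrow> ('N, 'n) array3) \<Rightarrow> bool" where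
  "has_weak_hessian u H \<longleftrightarrow>
     (\<forall>\<alpha> i j. has_weak_partial [i, j] (\<lambda>x. u x $ \<alpha>) (\<lambda>x. H x $ \<alpha> $ i $ j))"

(* A representative of D^2 u (if u has a weak Hessian), unique up to null sets and with values in sym_arrays almost
   everywhere. Functions u that agree almost everywhere have the same weak Hessians, so they get
   the same representative. *)
definition weak_hessian :: "(real^'n::finite \<Rightarrow> real^'N::finite) \<Rightarrow> real^'n \<Rightarrow> ('N, 'n) array3" where
  "weak_hessian u = (SOME H. has_weak_hessian u H)"

(* The exponents 2* = 2n/(n-2) and 2** = 2n/(n-4) are meant for n >= 5. *)
definition W22star :: "(real^'n::finite \<Rightarrow> real^'N::finite) set" where
  "W22star = {u. let n = real CARD('n) in
     u \<in> Lp (2 * n / (n - 4)) \<and>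
     (\<exists>A. has_weak_gradient u A \<and> A \<in> Lp (2 * n / (n - 2))) \<and>
     (\<exists>H. has_weak_hessian u H \<and> H \<in> Lp 2)}"

definition ae_eq :: "(real^'n::finite \<Rightarrow> 'b) \<Rightarrow> (real^'n \<Rightarrow> 'b) \<Rightarrow> bool" where
  "ae_eq f g \<longleftrightarrow> (AE x in lebesgue. f x = g x)"

definition hess_op ::
  "(real^'n::finite \<Rightarrow> ('N::finite, 'n) array3 \<Rightarrow> real^'N) \<Rightarrow> (real^'n \<Rightarrow> real^'N) \<Rightarrow> real^'n \<Rightarrow> real^'N" where
  "hess_op F u = (\<lambda>x. F x (weak_hessian u x))"

(* Bijectivity of the map that T induces between the quotients of A and B by ae_eq. *)
definition bij_ae ::
  "((real^'n::finite \<Rightarrow> 'b) \<Rightarrow> real^'n \<Rightarrow> 'c) \<Rightarrow> (real^'n \<Rightarrow> 'b) set \<Rightarrow> (real^'n \<Rightarrow> 'c) set \<Rightarrow> bool" where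
  "bij_ae T A B \<longleftrightarrow>
     (\<forall>u\<in>A. T u \<in> B) \<and>
     (\<forall>u\<in>A. \<forall>v\<in>A. ae_eq (T u) (T v) \<longleftrightarrow> ae_eq u v) \<and>
     (\<forall>f\<in>B. \<exists>u\<in>A. ae_eq (T u) f)"

definition ellipticity ::
  "(real^'n::finite \<Rightarrow> ('N::finite, 'n) array3 \<Rightarrow> real^'N) \<Rightarrow> ereal" where
  "ellipticity F =
     (INF (v, w) \<in> {(v, w). v \<in> W22star \<and> w \<in> W22star \<and> \<not> ae_eq v w}.
        ereal (Lp_norm 2 (\<lambda>x. hess_op F w x - hess_op F v x)
                 / Lp_norm 2 (\<lambda>x. weak_hessian w x - weak_hessian v x)))"

definition near_const ::
  "(real^'n::finite \<Rightarrow> ('N::finite, 'n) array3 \<Rightarrow> real^'N) \<Rightarrow>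
   (real^'n \<Rightarrow> ('N, 'n) array3 \<Rightarrow> real^'N) \<Rightarrow> ereal" where
  "near_const F G =
     esssup lebesgue (\<lambda>x.
       SUP (X, Y) \<in> {(X, Y). X \<in> sym_arrays \<and> Y \<in> sym_arrays \<and> X \<noteq> Y}.
         ereal (norm (((F x Y - F x X) - (G x Y - G x X)) /\<^sub>R norm (Y - X))))"

end

theory Submission
  imports Defs
begin

text \<open>
  If \<open>k\<close> exceeds the nearness constant and \<open>\<nu>\<close> is below the ellipticity constant of \<open>F\<close>, then
  \<open>\<parallel>(F[w] - F[v]) - (G[w] - G[v])\<parallel> \<le> k \<parallel>D\<^sup>2w - D\<^sup>2v\<parallel> \<le> (k / \<nu>) \<parallel>F[w] - F[v]\<parallel>\<close> in \<open>L\<^sup>2\<close>. For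
  \<open>k < \<nu>\<close> this gives uniqueness, and it makes \<open>f \<mapsto> f - G[F\<^sup>-\<^sup>1 f] + g\<close> a contraction of \<open>L\<^sup>2\<close>, whose
  fixed point \<open>f\<close> yields the solution \<open>u = F\<^sup>-\<^sup>1 f\<close>.

  The chosen representatives \<open>D\<^sup>2u\<close> are under control because weak derivatives are unique and
  symmetric. Both facts follow by testing against products of one-dimensional bumps: their iterated
  partial derivatives commute by an explicit formula, and they converge to indicators of boxes, which
  determine a locally integrable function almost everywhere.
\<close>

subsection \<open>Smooth bump functions\<close>

text \<open>For \<open>k = 0\<close> this is the classical smooth function exp(-1/t) extended by
  zero to the left. The powers of 1/t are included because differentiation produces them.\<close>

definition flat_exp :: "nat \<Rightarrow> real \<Rightarrow> real" where
  "flat_exp k t = (if t > 0 then inverse t ^ k * exp (- inverse t) else 0)"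

lemma power_le_fact_exp:
  assumes "0 \<le> (x::real)"
  shows "x ^ n \<le> fact n * exp x"
proof -
  have "(\<Sum>m\<in>{n}. x ^ m /\<^sub>R fact m) \<le> exp x"
    unfolding exp_def using assms by (intro sum_le_suminf summable_exp_generic) auto
  then show ?thesis by (simp add: field_simps)
qed

text \<open>The exponential estimate is used with exponent \<open>k + 2\<close>, two more than
  needed, and the surplus becomes the factor t squared. Decay faster than linear at the origin is
  what differentiability there requires.\<close>

lemma flat_exp_bound: "\<bar>flat_exp k t\<bar> \<le> fact (k + 2) * t\<^sup>2"
proof (cases "t > 0")
  case True
  have "inverse t ^ (k + 2) \<le> fact (k + 2) * exp (inverse t)"
    using True by (intro power_le_fact_exp) simp
  then have "inverse t ^ (k + 2) * exp (- inverse t) \<le> fact (k + 2)"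
    unfolding exp_minus divide_inverse[symmetric] by (subst pos_divide_le_eq) auto
  then have "inverse t ^ (k + 2) * exp (- inverse t) * t\<^sup>2 \<le> fact (k + 2) * t\<^sup>2"
    by (intro mult_right_mono) auto
  moreover have "inverse t ^ (k + 2) * exp (- inverse t) * t\<^sup>2 = flat_exp k t"
    using True by (simp add: flat_exp_def power_add power2_eq_square field_simps)
  moreover have "flat_exp k t \<ge> 0"
    using True by (simp add: flat_exp_def)
  ultimately show ?thesis by simp
qed (simp add: flat_exp_def)

lemma has_real_derivative_flat_exp:
  "(flat_exp k has_real_derivative flat_exp (k + 2) t - real k * flat_exp (k + 1) t) (at t)"
proof -
  consider "t > 0" | "t < 0" | "t = 0" by linarith
  then show ?thesis
  proof cases
    case 1
    have "((\<lambda>t. inverse t ^ k * exp (- inverse t)) has_real_derivative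
        flat_exp (k + 2) t - real k * flat_exp (k + 1) t) (at t)"
      using 1 by (auto intro!: derivative_eq_intros simp: flat_exp_def)
                 (cases k; simp add: field_simps power2_eq_square)
    then show ?thesis
      by (rule has_field_derivative_transform_within_open[of _ _ _ "{0<..}"])
         (use 1 in \<open>auto simp: flat_exp_def\<close>)
  next
    case 2
    have "((\<lambda>t. 0) has_real_derivative flat_exp (k + 2) t - real k * flat_exp (k + 1) t) (at t)"
      using 2 by (simp add: flat_exp_def)
    then show ?thesis
      by (rule has_field_derivative_transform_within_open[of _ _ _ "{..<0}"])
         (use 2 in \<open>auto simp: flat_exp_def\<close>)
  next
    case 3
    \<comment> \<open>At the origin the function and the claimed derivative both vanish, so only the
      bare quotient remains, and the quadratic bound makes it O(h).\<close>
    have "((\<lambda>h. flat_exp k h / h) \<longlongrightarrow> 0) (at 0)"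
    proof (rule Lim_null_comparison)
      show "\<forall>\<^sub>F h in at 0. norm (flat_exp k h / h) \<le> fact (k + 2) * \<bar>h\<bar>"
      proof (rule eventually_at_ball'[OF zero_less_one, THEN eventually_mono])
        fix h :: real
        assume "h \<in> ball 0 1 \<and> h \<noteq> 0 \<and> h \<in> UNIV"
        then show "norm (flat_exp k h / h) \<le> fact (k + 2) * \<bar>h\<bar>"
          using flat_exp_bound[of k h]
          by (simp add: divide_simps power2_eq_square mult.assoc del: fact_Suc)
      qed
      show "((\<lambda>h. fact (k + 2) * \<bar>h\<bar>) \<longlongrightarrow> (0::real)) (at 0)"
        by (auto intro!: tendsto_eq_intros simp del: fact_Suc)
    qed
    then show ?thesis
      using 3 by (simp add: DERIV_def flat_exp_def)
  qed
qed

text \<open>An algebra of smooth functions, because it is closed under differentiation.\<close>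

inductive_set flat_algebra :: "(real \<Rightarrow> real) set" where
  const: "(\<lambda>t. c) \<in> flat_algebra"
| affine: "(\<lambda>t. flat_exp k (c * t + d)) \<in> flat_algebra"
| add: "f \<in> flat_algebra \<Longrightarrow> g \<in> flat_algebra \<Longrightarrow> (\<lambda>t. f t + g t) \<in> flat_algebra"
| mult: "f \<in> flat_algebra \<Longrightarrow> g \<in> flat_algebra \<Longrightarrow> (\<lambda>t. f t * g t) \<in> flat_algebra"

lemma flat_algebra_has_derivative:
  "f \<in> flat_algebra \<Longrightarrow> \<exists>f'\<in>flat_algebra. \<forall>t. (f has_real_derivative f' t) (at t)"
proof (induction rule: flat_algebra.induct)
  case (const c)
  then show ?case by (auto intro!: bexI[OF _ flat_algebra.const[of 0]])
next
  case (affine k c d)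
  \<comment> \<open>The chain rule derivative, with the subtraction rewritten as addition of a
    constant multiple so that it is visibly built from the generators.\<close>
  let ?f' = "\<lambda>t. c * (flat_exp (k + 2) (c * t + d) + (- real k) * flat_exp (k + 1) (c * t + d))"
  have "?f' \<in> flat_algebra"
    by (intro flat_algebra.mult flat_algebra.add flat_algebra.const flat_algebra.affine)
  moreover have "((\<lambda>t. flat_exp k (c * t + d)) has_real_derivative ?f' t) (at t)" for t
    by (rule DERIV_cong[OF DERIV_chain2[OF has_real_derivative_flat_exp]])
       (auto intro!: derivative_eq_intros)
  ultimately show ?case by (intro bexI[of _ ?f']) auto
next
  case (add f g)
  then obtain f' g' where "f' \<in> flat_algebra" "g' \<in> flat_algebra"
    and d: "\<And>t. (f has_real_derivative f' t) (at t)" "\<And>t. (g has_real_derivative g' t) (at t)"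
    by blast
  then show ?case
    by (intro bexI[of _ "\<lambda>t. f' t + g' t"]) (auto intro: DERIV_add flat_algebra.add)
next
  case (mult f g)
  then obtain f' g' where "f' \<in> flat_algebra" "g' \<in> flat_algebra"
    and d: "\<And>t. (f has_real_derivative f' t) (at t)" "\<And>t. (g has_real_derivative g' t) (at t)"
    by blast
  then show ?case using mult.hyps
    by (intro bexI[of _ "\<lambda>t. f' t * g t + g' t * f t"])
       (auto intro: DERIV_mult flat_algebra.intros)
qed

lemma deriv_flat_algebra:
  assumes "f \<in> flat_algebra"
  shows "deriv f \<in> flat_algebra" "(f has_real_derivative deriv f t) (at t)"
proof -
  obtain f' where f': "f' \<in> flat_algebra" "\<And>t. (f has_real_derivative f' t) (at t)"
    using flat_algebra_has_derivative[OF assms] by blast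
  then have "deriv f = f'" using DERIV_imp_deriv by blast
  with f' show "deriv f \<in> flat_algebra" "(f has_real_derivative deriv f t) (at t)" by auto
qed

lemma funpow_deriv_flat_algebra: "f \<in> flat_algebra \<Longrightarrow> (deriv ^^ k) f \<in> flat_algebra"
  by (induction k) (auto intro: deriv_flat_algebra)

section \<open>Products of functions of single coordinates\<close>

lemma has_derivative_prod_coordinates:
  fixes f :: "'n::finite \<Rightarrow> real \<Rightarrow> real"
  assumes "\<And>j. f j \<in> flat_algebra"
  shows "((\<lambda>x::real^'n. \<Prod>j\<in>UNIV. f j (x $ j)) has_derivative
    (\<lambda>y. \<Sum>j\<in>UNIV. deriv (f j) (x $ j) * y $ j * (\<Prod>k\<in>UNIV - {j}. f k (x $ k)))) (at x)"
proof (rule has_derivative_prod)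
  fix j
  show "((\<lambda>x. f j (x $ j)) has_derivative (\<lambda>y. deriv (f j) (x $ j) * y $ j)) (at x)"
    by (rule has_derivative_compose[OF bounded_linear_imp_has_derivative[OF bounded_linear_vec_nth]
        deriv_flat_algebra(2)[OF assms, unfolded has_field_derivative_def]])
qed

text \<open>In the product rule the direction \<open>axis i 1\<close> annihilates every summand
  except the one that differentiates factor \<open>i\<close>.\<close>

lemma partial_prod_coordinates:
  fixes f :: "'n::finite \<Rightarrow> real \<Rightarrow> real"
  assumes "\<And>j. f j \<in> flat_algebra"
  shows "partial i (\<lambda>x. \<Prod>j\<in>UNIV. f j (x $ j)) =
    (\<lambda>x. \<Prod>j\<in>UNIV. (if j = i then deriv (f j) else f j) (x $ j))"
proof
  fix x :: "real^'n"
  have "partial i (\<lambda>x. \<Prod>j\<in>UNIV. f j (x $ j)) x =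
      (\<Sum>j\<in>UNIV. deriv (f j) (x $ j) * axis i 1 $ j * (\<Prod>k\<in>UNIV - {j}. f k (x $ k)))"
    unfolding partial_def
    by (subst frechet_derivative_at[OF has_derivative_prod_coordinates[OF assms], symmetric]) simp
  also have "\<dots> = (\<Sum>j\<in>UNIV. if i = j then deriv (f j) (x $ j) * (\<Prod>k\<in>UNIV - {j}. f k (x $ k)) else 0)"
    by (intro sum.cong) (auto simp: axis_def)
  also have "\<dots> = deriv (f i) (x $ i) * (\<Prod>k\<in>UNIV - {i}. f k (x $ k))"
    by simp
  also have "\<dots> = (\<Prod>j\<in>UNIV. (if j = i then deriv (f j) else f j) (x $ j))"
    by (subst prod.remove[of UNIV i]) auto
  finally show "partial i (\<lambda>x. \<Prod>j\<in>UNIV. f j (x $ j)) x = \<dots>" .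
qed

text \<open>Each partial derivative touches only its own factor, so the order of the list disappears
  and only multiplicities survive. Commutation of derivatives is thereby read off from the
  formula.\<close>

lemma iter_partial_prod_coordinates:
  fixes f :: "'n::finite \<Rightarrow> real \<Rightarrow> real"
  assumes "\<And>j. f j \<in> flat_algebra"
  shows "iter_partial is (\<lambda>x. \<Prod>j\<in>UNIV. f j (x $ j)) =
    (\<lambda>x. \<Prod>j\<in>UNIV. (deriv ^^ count_list is j) (f j) (x $ j))"
proof (induction "is")
  case (Cons i "is")
  then show ?case
    by (simp only: iter_partial.simps)
       (subst partial_prod_coordinates, auto intro!: ext prod.cong funpow_deriv_flat_algebra assms)
qed simp

lemma smooth_prod_coordinates:
  fixes f :: "'n::finite \<Rightarrow> real \<Rightarrow> real"
  assumes "\<And>j. f j \<in> flat_algebra"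
  shows "smooth (\<lambda>x. \<Prod>j\<in>UNIV. f j (x $ j))"
  unfolding smooth_def iter_partial_prod_coordinates[OF assms] differentiable_on_def
  by (auto simp: differentiable_def
      intro!: exI has_derivative_prod_coordinates funpow_deriv_flat_algebra assms)

section \<open>Bumps that approximate indicators of boxes\<close>

definition box_bump :: "nat \<Rightarrow> real^'n \<Rightarrow> real^'n \<Rightarrow> real^'n::finite \<Rightarrow> real" where
  "box_bump m a b x =
    (\<Prod>j\<in>UNIV. flat_exp 0 (real (Suc m) * (x $ j - a $ j)) * flat_exp 0 (real (Suc m) * (b $ j - x $ j)))"

text \<open>The factors are brought into the form \<open>c * t + d\<close> of the generators, which
  makes the formulas for coordinate products applicable.\<close>

lemma box_bump_eq_prod:
  "\<exists>f. (\<forall>j. f j \<in> flat_algebra) \<and> box_bump m a b = (\<lambda>x. \<Prod>j\<in>UNIV. f j (x $ j))"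
proof (intro exI conjI allI)
  let ?f = "\<lambda>j t. flat_exp 0 (real (Suc m) * t + - real (Suc m) * (a $ j)) *
      flat_exp 0 (- real (Suc m) * t + real (Suc m) * (b $ j))"
  show "?f j \<in> flat_algebra" for j
    by (intro flat_algebra.intros)
  show "box_bump m a b = (\<lambda>x. \<Prod>j\<in>UNIV. ?f j (x $ j))"
    by (auto simp: box_bump_def algebra_simps intro!: ext prod.cong)
qed

lemma flat_exp_0_bounds: "0 \<le> flat_exp 0 t" "flat_exp 0 t \<le> 1"
  by (auto simp: flat_exp_def)

lemma box_bump_bounds: "0 \<le> box_bump m a b x" "box_bump m a b x \<le> 1"
proof -
  show "0 \<le> box_bump m a b x"
    unfolding box_bump_def by (intro prod_nonneg mult_nonneg_nonneg flat_exp_0_bounds)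
  show "box_bump m a b x \<le> 1"
    unfolding box_bump_def by (intro prod_le_1 conjI mult_nonneg_nonneg mult_le_one flat_exp_0_bounds)
qed

lemma box_bump_outside:
  assumes "x \<notin> box a b"
  shows "box_bump m a b x = 0"
proof -
  obtain j where "x $ j - a $ j \<le> 0 \<or> b $ j - x $ j \<le> 0"
    using assms by (auto simp: mem_box_cart not_less)
  then have "real (Suc m) * (x $ j - a $ j) \<le> 0 \<or> real (Suc m) * (b $ j - x $ j) \<le> 0"
    by (auto intro: mult_nonneg_nonpos)
  then have "flat_exp 0 (real (Suc m) * (x $ j - a $ j)) * flat_exp 0 (real (Suc m) * (b $ j - x $ j)) = 0"
    unfolding flat_exp_def by (smt (verit) mult_eq_0_iff)
  then show ?thesis
    unfolding box_bump_def by (intro prod_zero) auto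
qed

lemma test_function_box_bump: "test_function (box_bump m a b)"
proof -
  have "{x. box_bump m a b x \<noteq> 0} \<subseteq> cbox a b"
    using box_bump_outside[of _ a b m] box_subset_cbox[of a b] by blast
  then have "bounded {x. box_bump m a b x \<noteq> 0}"
    using bounded_subset[OF bounded_cbox] by blast
  then have "compact (closure {x. box_bump m a b x \<noteq> 0})"
    by simp
  moreover obtain f where "\<And>j. f j \<in> flat_algebra" "box_bump m a b = (\<lambda>x. \<Prod>j\<in>UNIV. f j (x $ j))"
    using box_bump_eq_prod[of m a b] by blast
  ultimately show ?thesis
    unfolding test_function_def using smooth_prod_coordinates[of f] by simp
qed

text \<open>Inside the box every factor is exp(-1/((m + 1) t)) with t > 0, so growing steepness
  drives it to 1. Outside the box all bumps vanish.\<close>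

lemma box_bump_tendsto_indicator:
  "(\<lambda>m. box_bump m a b x) \<longlonglongrightarrow> indicator (box a b) x"
proof (cases "x \<in> box a b")
  case True
  have *: "(\<lambda>m. flat_exp 0 (real (Suc m) * t)) \<longlonglongrightarrow> 1" if "t > 0" for t
  proof -
    have "(\<lambda>m. exp (- (inverse (real (Suc m)) * inverse t))) \<longlonglongrightarrow> exp (- (0 * inverse t))"
      by (intro tendsto_intros LIMSEQ_inverse_real_of_nat)
    then show ?thesis using that by (simp add: flat_exp_def)
  qed
  have "(\<lambda>m. \<Prod>j\<in>UNIV. flat_exp 0 (real (Suc m) * (x $ j - a $ j)) *
      flat_exp 0 (real (Suc m) * (b $ j - x $ j))) \<longlonglongrightarrow> (\<Prod>j\<in>(UNIV :: 'a set). 1 * 1)"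
    using True by (intro tendsto_prod tendsto_mult *) (auto simp: mem_box_cart)
  then show ?thesis using True by (simp add: box_bump_def)
qed (simp add: box_bump_outside)

subsection \<open>Uniqueness of weak derivatives\<close>

text \<open>Completion preserves the measure of Borel sets, so a countable cover for
  \<open>lborel\<close> serves again.\<close>

lemma sigma_finite_lebesgue: "sigma_finite_measure (lebesgue :: 'a::euclidean_space measure)"
proof
  obtain A :: "'a set set" where "countable A" "A \<subseteq> sets lborel" "\<Union> A = space lborel" "\<forall>a\<in>A. emeasure lborel a \<noteq> \<infinity>"
    using lborel.sigma_finite_countable by blast
  then show "\<exists>A :: 'a set set. countable A \<and> A \<subseteq> sets lebesgue \<and> \<Union> A = space lebesgue \<and>
      (\<forall>a\<in>A. emeasure lebesgue a \<noteq> \<infinity>)"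
    by (intro exI[of _ A]) (auto simp: subset_eq)
qed

text \<open>Boxes form an intersection-stable generator of the Borel sets. Vanishing integrals
  therefore extend from boxes to Borel sets by a Dynkin argument, then to Lebesgue sets, and this
  forces the function to vanish.\<close>

lemma AE_zero_if_box_integrals_zero:
  fixes v :: "real^'n::finite \<Rightarrow> real"
  assumes loc: "locally_integrable v"
    and box: "\<And>a b. (\<integral>x. indicator (box a b) x * v x \<partial>lebesgue) = 0"
  shows "AE x in lebesgue. v x = 0"
proof -
  have int: "integrable lebesgue (\<lambda>x. indicator (box a b) x * v x)" for a b
    using loc set_integrable_subset[of lebesgue "cbox a b" v "box a b"]
    by (auto simp: locally_integrable_def set_integrable_def box_subset_cbox)
  \<comment> \<open>Local integrability only controls bounded regions, so the argument runs on one
    box at a time.\<close>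
  have on_box: "AE x in lebesgue. indicator (box a b) x * v x = 0" for a b
  proof (rule sigma_finite_measure.density_zero[OF sigma_finite_lebesgue int])
    let ?w = "\<lambda>x. indicator (box a b) x * v x"
    have intw: "integrable lebesgue (\<lambda>x. indicator A x * ?w x)" if "A \<in> sets lebesgue" for A
      using integrable_mult_indicator[OF that int[of a b]] by simp
    have borel: "(\<integral>x. indicator A x * ?w x \<partial>lebesgue) = 0" if "A \<in> sets borel" for A
    proof -
      have "Int_stable (range (\<lambda>(a, b). box a b :: (real^'n) set))"
        by (auto simp: Int_stable_def box_Int_box)
      moreover have "range (\<lambda>(a, b). box a b :: (real^'n) set) \<subseteq> Pow UNIV"
        by auto
      moreover have "A \<in> sigma_sets UNIV (range (\<lambda>(a, b). box a b))"
        using that unfolding borel_eq_box by simp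
      ultimately show ?thesis
      proof (induction rule: sigma_sets_induct_disjoint)
        case (basic A)
        then obtain c d where "A = box c d" by auto
        have "(\<integral>x. indicator A x * ?w x \<partial>lebesgue) = (\<integral>x. indicator (A \<inter> box a b) x * v x \<partial>lebesgue)"
          by (intro Bochner_Integration.integral_cong) (auto simp: indicator_def)
        then show ?case using \<open>A = box c d\<close> box by (simp add: box_Int_box)
      next
        case empty
        then show ?case by simp
      next
        case (compl A)
        then have "A \<in> sets lebesgue" by (simp add: borel_eq_box)
        have "indicator (UNIV - A) x * ?w x = ?w x - indicator A x * ?w x" for x
          by (auto simp: indicator_def)
        then show ?case
          using compl.IH Bochner_Integration.integral_diff[OF int[of a b] intw[OF \<open>A \<in> sets lebesgue\<close>]]
          by (simp add: box)
      next
        case (union F)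
        then have "F i \<in> sets borel" for i by (simp add: borel_eq_box image_subset_iff)
        then have F: "F i \<in> sets lebesgue" for i by simp
        have "(\<integral>x\<in>(\<Union>i. F i). ?w x \<partial>lebesgue) = (\<Sum>i. (\<integral>x\<in>F i. ?w x \<partial>lebesgue))"
          by (rule lebesgue_integral_countable_add)
             (use F union.hyps intw[of "\<Union>i. F i"] in \<open>auto simp: disjoint_family_on_def set_integrable_def\<close>)
        then show ?case using union.IH by (simp add: set_lebesgue_integral_def)
      qed
    qed
    fix A :: "(real^'n) set" assume A: "A \<in> sets lebesgue"
    \<comment> \<open>A Lebesgue set is a Borel set up to a null set, which does not affect the
      integral.\<close>
    obtain S N N' where *: "A = S \<union> N" "N \<subseteq> N'" "N' \<in> null_sets lborel" "S \<in> sets lborel"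
      using A by (rule sets_completionE)
    have "AE x in lebesgue. x \<notin> N'"
      using * by (intro AE_not_in null_sets_completionI)
    then have "(\<integral>x. indicator A x * ?w x \<partial>lebesgue) = (\<integral>x. indicator S x * ?w x \<partial>lebesgue)"
      using * A by (intro integral_cong_AE borel_measurable_integrable intw)
                   (auto simp: indicator_def elim!: eventually_mono)
    then show "set_lebesgue_integral lebesgue A ?w = 0"
      using borel * by (simp add: set_lebesgue_integral_def)
  qed
  \<comment> \<open>Countably many boxes exhaust the space, so the exceptional null sets can be
    united.\<close>
  have "AE x in lebesgue. \<forall>m::nat. indicator (box (- (real m *\<^sub>R One)) (real m *\<^sub>R One)) x * v x = 0"
    unfolding AE_all_countable using on_box by blast
  then show ?thesis
  proof eventually_elim
    case (elim x)
    have "x \<in> (\<Union>m::nat. box (- (real m *\<^sub>R One)) (real m *\<^sub>R One))"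
      by (subst UN_box_eq_UNIV) (rule UNIV_I)
    then obtain m where "x \<in> box (- (real m *\<^sub>R One)) (real m *\<^sub>R One)"
      by (rule UN_E)
    then show ?case using elim[rule_format, of m] by simp
  qed
qed

text \<open>The bump is continuous, bounded by 1 and zero outside the compact set
  \<open>cbox a b\<close>, so the product is dominated by the truncation of \<open>v\<close> to that
  set.\<close>

lemma locally_integrable_mult_box_bump:
  assumes "locally_integrable v"
  shows "integrable lebesgue (\<lambda>x. v x * box_bump m a b x)"
proof -
  have int: "integrable lebesgue (\<lambda>x. indicator (cbox a b) x * v x)"
    using assms by (simp add: locally_integrable_def set_integrable_def)
  obtain f where f: "\<And>j. f j \<in> flat_algebra" "box_bump m a b = (\<lambda>x. \<Prod>j\<in>UNIV. f j (x $ j))"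
    using box_bump_eq_prod[of m a b] by blast
  have "continuous_on UNIV (box_bump m a b)"
    unfolding f(2)
    by (intro has_derivative_continuous_on[OF has_derivative_at_withinI[OF has_derivative_prod_coordinates]] f)
  then have [measurable]: "box_bump m a b \<in> borel_measurable lebesgue"
    by (intro measurable_completion) (simp add: borel_measurable_continuous_onI)
  have "integrable lebesgue (\<lambda>x. (indicator (cbox a b) x * v x) * box_bump m a b x)"
    using box_bump_bounds[of m a b]
    by (intro Bochner_Integration.integrable_bound[OF int]
          borel_measurable_times[OF borel_measurable_integrable[OF int]])
       (auto simp: abs_mult intro!: AE_I2 mult_left_le)
  moreover have "(indicator (cbox a b) x * v x) * box_bump m a b x = v x * box_bump m a b x" for x
    using box_bump_outside[of x a b m] box_subset_cbox[of a b] by (auto simp: indicator_def)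
  ultimately show ?thesis by simp
qed

text \<open>Box bumps have iterated derivatives that depend only on the multiset of indices, so
  \<open>v\<close> and \<open>w\<close> have the same integrals against them. Comparing multisets
  instead of lists yields uniqueness and symmetry of weak derivatives at once.\<close>

lemma has_weak_partial_unique:
  assumes "has_weak_partial is u v" "has_weak_partial js u w" "mset is = mset js"
  shows "AE x in lebesgue. v x = w x"
proof -
  have lv: "locally_integrable v" and lw: "locally_integrable w"
    using assms by (auto simp: has_weak_partial_def)
  have "locally_integrable (\<lambda>x. v x - w x)"
    using lv lw by (auto simp: locally_integrable_def intro: set_integral_diff)
  moreover have "(\<integral>x. indicator (box a b) x * (v x - w x) \<partial>lebesgue) = 0" for a b
  proof -
    have zero: "(\<integral>x. (v x - w x) * box_bump m a b x \<partial>lebesgue) = 0" for m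
    proof -
      obtain f where f: "\<And>j. f j \<in> flat_algebra" "box_bump m a b = (\<lambda>x. \<Prod>j\<in>UNIV. f j (x $ j))"
        using box_bump_eq_prod[of m a b] by blast
      have "iter_partial is (box_bump m a b) = iter_partial js (box_bump m a b)"
        unfolding f(2) iter_partial_prod_coordinates[OF f(1)]
        by (simp flip: count_mset add: assms(3))
      moreover have "length is = length js"
        using assms(3) by (metis size_mset)
      ultimately have "(\<integral>x. v x * box_bump m a b x \<partial>lebesgue) = (\<integral>x. w x * box_bump m a b x \<partial>lebesgue)"
        using assms(1,2) test_function_box_bump[of m a b]
        by (auto simp: has_weak_partial_def)
      then show ?thesis
        using Bochner_Integration.integral_diff[OF locally_integrable_mult_box_bump[OF lv]
            locally_integrable_mult_box_bump[OF lw]]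
        by (simp add: left_diff_distrib)
    qed
    \<comment> \<open>Dominated convergence replaces bumps by the indicator. The majorant lives on
      the closed box because local integrability is stated for compact sets.\<close>
    have "(\<lambda>m. \<integral>x. (v x - w x) * box_bump m a b x \<partial>lebesgue)
        \<longlonglongrightarrow> (\<integral>x. indicator (box a b) x * (v x - w x) \<partial>lebesgue)"
    proof (rule integral_dominated_convergence)
      let ?d = "\<lambda>x. indicator (cbox a b) x * (v x - w x)"
      have ibox: "integrable lebesgue (\<lambda>x. indicator S x * (v x - w x))"
        if "S = box a b \<or> S = cbox a b" for S
        using \<open>locally_integrable (\<lambda>x. v x - w x)\<close> that
          set_integrable_subset[of lebesgue "cbox a b" "\<lambda>x. v x - w x" S] box_subset_cbox[of a b]
        by (auto simp: locally_integrable_def set_integrable_def)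
      show "integrable lebesgue (\<lambda>x. \<bar>?d x\<bar>)"
        using ibox by (intro integrable_abs) auto
      show "(\<lambda>x. indicator (box a b) x * (v x - w x)) \<in> borel_measurable lebesgue"
        using ibox by blast
      show "(\<lambda>x. (v x - w x) * box_bump m a b x) \<in> borel_measurable lebesgue" for m
        using locally_integrable_mult_box_bump[OF \<open>locally_integrable (\<lambda>x. v x - w x)\<close>] by blast
      show "AE x in lebesgue. (\<lambda>m. (v x - w x) * box_bump m a b x)
          \<longlonglongrightarrow> indicator (box a b) x * (v x - w x)"
        unfolding mult.commute[of "indicator (box a b) _"]
        by (intro AE_I2 tendsto_mult tendsto_const box_bump_tendsto_indicator)
      show "AE x in lebesgue. norm ((v x - w x) * box_bump m a b x) \<le> \<bar>?d x\<bar>" for m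
      proof (rule AE_I2)
        fix x
        show "norm ((v x - w x) * box_bump m a b x) \<le> \<bar>?d x\<bar>"
        proof (cases "x \<in> cbox a b")
          case True
          then show ?thesis using box_bump_bounds[of m a b x] by (auto simp: abs_mult intro!: mult_left_le)
        next
          case False
          then have "x \<notin> box a b" using box_subset_cbox by blast
          then show ?thesis by (simp add: box_bump_outside)
        qed
      qed
    qed
    then show ?thesis by (simp add: zero LIMSEQ_const_iff)
  qed
  ultimately have "AE x in lebesgue. v x - w x = 0"
    by (rule AE_zero_if_box_integrals_zero)
  then show ?thesis by simp
qed

section \<open>Weak Hessians and their chosen representatives\<close>

lemma has_weak_hessian_unique:
  assumes "has_weak_hessian u H" "has_weak_hessian u H'"
  shows "AE x in lebesgue. H x = H' x"
proof -
  have "AE x in lebesgue. \<forall>\<alpha> i j. H x $ \<alpha> $ i $ j = H' x $ \<alpha> $ i $ j"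
    unfolding AE_all_countable
    using assms by (auto simp: has_weak_hessian_def intro!: has_weak_partial_unique)
  then show ?thesis by (simp add: vec_eq_iff)
qed

text \<open>The lists \<open>[i, j]\<close> and \<open>[j, i]\<close> have the same
  multiset.\<close>

lemma has_weak_hessian_symmetric:
  assumes "has_weak_hessian u H"
  shows "AE x in lebesgue. H x \<in> sym_arrays"
proof -
  have "AE x in lebesgue. H x $ \<alpha> $ i $ j = H x $ \<alpha> $ j $ i" for \<alpha> i j
    using assms by (intro has_weak_partial_unique[of "[i, j]" _ _ "[j, i]"])
      (auto simp: has_weak_hessian_def)
  then have "AE x in lebesgue. \<forall>\<alpha> i j. H x $ \<alpha> $ i $ j = H x $ \<alpha> $ j $ i"
    unfolding AE_all_countable by blast
  then show ?thesis by (simp add: sym_arrays_def)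
qed

lemma weak_hessian_AE_eq:
  assumes "has_weak_hessian u H"
  shows "AE x in lebesgue. weak_hessian u x = H x"
  unfolding weak_hessian_def
  by (rule has_weak_hessian_unique[OF someI[of "has_weak_hessian u", OF assms] assms])

lemma has_weak_partial_zero: "has_weak_partial is (\<lambda>x. 0) (\<lambda>x. 0)"
  by (simp add: has_weak_partial_def locally_integrable_def set_integrable_def)

lemma weak_hessian_zero:
  "AE x in lebesgue. weak_hessian (\<lambda>x :: real^'n::finite. 0 :: real^'N::finite) x = 0"
  by (rule weak_hessian_AE_eq) (simp add: has_weak_hessian_def has_weak_partial_zero)

lemma zero_in_Lp: "(\<lambda>x. 0) \<in> Lp p"
  by (simp add: Lp_def)

text \<open>The zero function is the reference point at which the value of \<open>hess_op G\<close>
  is known.\<close>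

lemma zero_in_W22star: "(\<lambda>x. 0) \<in> W22star"
proof -
  have "has_weak_gradient (\<lambda>x. 0) (\<lambda>x. 0)" "has_weak_hessian (\<lambda>x. 0) (\<lambda>x. 0)"
    by (simp_all add: has_weak_gradient_def has_weak_hessian_def has_weak_partial_zero)
  then show ?thesis
    unfolding W22star_def Let_def by (blast intro: zero_in_Lp)
qed

lemma Lp_AE_cong:
  fixes f g :: "real^'n::finite \<Rightarrow> 'b::euclidean_space"
  assumes "f \<in> Lp p" "AE x in lebesgue. f x = g x"
  shows "g \<in> Lp p"
proof -
  have [measurable]: "f \<in> borel_measurable lebesgue" and int: "integrable lebesgue (\<lambda>x. norm (f x) powr p)"
    using assms by (auto simp: Lp_def)
  have g[measurable]: "g \<in> borel_measurable lebesgue"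
    by (rule borel_measurable_AE[OF _ assms(2)]) simp
  have "integrable lebesgue (\<lambda>x. norm (g x) powr p)"
    by (rule integrable_cong_AE_imp[OF int]) (use assms(2) in auto)
  then show ?thesis using g by (simp add: Lp_def)
qed

text \<open>The space provides some square integrable Hessian; by uniqueness its properties pass to
  the representative picked by \<open>weak_hessian\<close>.\<close>

lemma weak_hessian_W22star:
  assumes "u \<in> W22star"
  shows "weak_hessian u \<in> Lp 2" "AE x in lebesgue. weak_hessian u x \<in> sym_arrays"
proof -
  obtain H where H: "has_weak_hessian u H" "H \<in> Lp 2"
    using assms by (auto simp: W22star_def Let_def)
  have "AE x in lebesgue. H x = weak_hessian u x"
    using weak_hessian_AE_eq[OF H(1)] by auto
  then show "weak_hessian u \<in> Lp 2" by (rule Lp_AE_cong[OF H(2)])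
  show "AE x in lebesgue. weak_hessian u x \<in> sym_arrays"
    using weak_hessian_AE_eq[OF H(1)] has_weak_hessian_symmetric[OF H(1)] by eventually_elim simp
qed

subsection \<open>Superposition operators\<close>

text \<open>For simple functions in place of \<open>H\<close> only measurability in \<open>x\<close>
  is needed, since they take finitely many values. Continuity in the second argument carries this
  over to the limit.\<close>

lemma caratheodory_compose_measurable:
  fixes F :: "real^'n::finite \<Rightarrow> ('N::finite, 'n) array3 \<Rightarrow> real^'N"
  assumes F: "caratheodory F" and H: "H \<in> borel_measurable lebesgue"
    and sym: "AE x in lebesgue. H x \<in> sym_arrays"
  shows "(\<lambda>x. F x (H x)) \<in> borel_measurable lebesgue"
proof -
  \<comment> \<open>The approximating simple functions need not be symmetric, while \<open>F\<close>
    is controlled only on \<open>sym_arrays\<close>. The symmetrization \<open>P\<close> is a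
    continuous retraction onto that set.\<close>
  define P :: "('N, 'n) array3 \<Rightarrow> ('N, 'n) array3"
    where "P X = (\<chi> \<alpha> i j. (X $ \<alpha> $ i $ j + X $ \<alpha> $ j $ i) / 2)" for X
  have P_sym: "P X \<in> sym_arrays" for X
    by (simp add: P_def sym_arrays_def add.commute)
  have P_id: "P X = X" if "X \<in> sym_arrays" for X
    using that by (auto simp: P_def sym_arrays_def vec_eq_iff)
  have P_cont: "continuous_on UNIV P"
    unfolding P_def by (intro continuous_intros) simp
  obtain s where s: "\<And>i. simple_function lebesgue (s i)" "\<And>x. (\<lambda>i. s i x) \<longlonglongrightarrow> H x"
    using borel_measurable_implies_sequence_metric[OF H, of 0] by auto
  have meas: "(\<lambda>x. F x (P (s i x))) \<in> borel_measurable lebesgue" for i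
  proof (rule measurable_compose_countable'[where g = "s i" and I = "range (s i)"])
    show "(\<lambda>x. F x (P X)) \<in> borel_measurable lebesgue" for X
      using F P_sym by (simp add: caratheodory_def)
    show "s i \<in> measurable lebesgue (count_space (range (s i)))"
      using measurable_simple_function[OF s(1)] by (auto simp: measurable_def)
    show "countable (range (s i))"
      using simple_functionD(1)[OF s(1)] by (simp add: countable_finite)
  qed
  have "AE x in lebesgue. continuous_on sym_arrays (F x) \<and> H x \<in> sym_arrays"
    using F sym by (auto simp: caratheodory_def)
  then obtain N where N: "N \<in> null_sets lebesgue"
    "\<And>x. x \<notin> N \<Longrightarrow> continuous_on sym_arrays (F x) \<and> H x \<in> sym_arrays"
    unfolding completion.AE_iff_null_sets by auto
  define A where "A = UNIV - N"
  have A: "AE x in lebesgue. x \<in> A" "A \<in> sets lebesgue"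
    "\<And>x. x \<in> A \<Longrightarrow> continuous_on sym_arrays (F x) \<and> H x \<in> sym_arrays"
    using N AE_not_in[OF N(1)] by (auto simp: A_def)
  have lim: "(\<lambda>i. F x (P (s i x))) \<longlonglongrightarrow> F x (H x)" if "x \<in> A" for x
  proof (rule continuous_on_tendsto_compose[of sym_arrays "F x"])
    show "continuous_on sym_arrays (F x)" "H x \<in> sym_arrays" using A(3) that by auto
    show "(\<lambda>i. P (s i x)) \<longlonglongrightarrow> H x"
      using continuous_on_tendsto_compose[OF P_cont s(2)[of x]] P_id[of "H x"] A(3)[OF that] by simp
  qed (simp add: P_sym)
  \<comment> \<open>Setting the functions to 0 off \<open>A\<close> turns convergence almost
    everywhere into convergence everywhere.\<close>
  have "(\<lambda>x. if x \<in> A then F x (H x) else 0) \<in> borel_measurable lebesgue"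
  proof (rule borel_measurable_LIMSEQ_metric)
    show "(\<lambda>x. if x \<in> A then F x (P (s i x)) else 0) \<in> borel_measurable lebesgue" for i
      by (rule measurable_If_set[OF meas]) (use A(2) in simp_all)
    show "(\<lambda>i. if x \<in> A then F x (P (s i x)) else 0) \<longlonglongrightarrow> (if x \<in> A then F x (H x) else 0)" for x
      using lim[of x] by simp
  qed
  then show ?thesis
    by (rule borel_measurable_AE) (use A(1) in auto)
qed

subsection \<open>Completeness and contractions in L2\<close>

text \<open>Telescoping against a geometric series gives both convergence and the rate. The limit is
  written as \<open>lim y\<close> so that pointwise limits of measurable functions are later
  measurable by construction.\<close>

lemma geometric_increments_limit:
  fixes y :: "nat \<Rightarrow> 'a::banach"
  assumes step: "\<And>k. norm (y (Suc k) - y k) \<le> T * p ^ k" and p: "0 \<le> p" "p < 1"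
  shows "y \<longlonglongrightarrow> lim y" "norm (y m - lim y) \<le> T * p ^ m / (1 - p)"
proof -
  have "0 \<le> T" using order_trans[OF norm_ge_zero step[of 0]] by simp
  have bound: "norm (y (m + n) - y m) \<le> T * p ^ m / (1 - p)" for m n
  proof -
    \<comment> \<open>The exact partial sum of the geometric series is kept, since the cruder bound
      would not survive the induction.\<close>
    have "norm (y (m + n) - y m) \<le> T * p ^ m * (1 - p ^ n) / (1 - p)"
    proof (induction n)
      case (Suc n)
      have "norm (y (m + Suc n) - y m) \<le> norm (y (Suc (m + n)) - y (m + n)) + norm (y (m + n) - y m)"
        using norm_triangle_ineq[of "y (Suc (m + n)) - y (m + n)" "y (m + n) - y m"] by simp
      also have "\<dots> \<le> T * p ^ (m + n) + T * p ^ m * (1 - p ^ n) / (1 - p)"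
        using step Suc by (intro add_mono)
      also have "\<dots> = T * p ^ m * (1 - p ^ Suc n) / (1 - p)"
        using p by (simp add: field_simps power_add)
      finally show ?case .
    qed simp
    also have "\<dots> \<le> T * p ^ m / (1 - p)"
      using p \<open>0 \<le> T\<close> by (intro divide_right_mono mult_left_le) auto
    finally show ?thesis .
  qed
  have "Cauchy y"
  proof (rule metric_CauchyI)
    fix e :: real assume "e > 0"
    have "(\<lambda>m. T * p ^ m / (1 - p)) \<longlonglongrightarrow> T * 0 / (1 - p)"
      using p by (intro tendsto_intros LIMSEQ_power_zero) auto
    then have "\<forall>\<^sub>F m in sequentially. T * p ^ m / (1 - p) < e / 2"
      using \<open>e > 0\<close> by (intro order_tendstoD(2)) auto
    then obtain M where "T * p ^ M / (1 - p) < e / 2"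
      by (auto simp: eventually_sequentially)
    then have "dist (y n) (y M) < e / 2" if "n \<ge> M" for n
      using bound[of M "n - M"] that by (simp add: dist_norm del: less_divide_eq_numeral1)
    then show "\<exists>M. \<forall>m\<ge>M. \<forall>n\<ge>M. dist (y m) (y n) < e"
      by (meson dist_triangle_half_l)
  qed
  then show lim: "y \<longlonglongrightarrow> lim y"
    by (simp add: Cauchy_convergent_iff convergent_LIMSEQ_iff)
  have "(\<lambda>n. y m - y n) \<longlonglongrightarrow> y m - lim y"
    by (intro tendsto_intros lim)
  then show "norm (y m - lim y) \<le> T * p ^ m / (1 - p)"
  proof (rule Lim_norm_ubound[rotated])
    show "\<forall>\<^sub>F n in sequentially. norm (y m - y n) \<le> T * p ^ m / (1 - p)"
      using eventually_ge_at_top[of m]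
    proof eventually_elim
      case (elim n)
      then show ?case using bound[of m "n - m"] by (simp add: norm_minus_commute)
    qed
  qed simp
qed

lemma norm_add_squared_le: "(norm (a + b :: 'a::real_normed_vector))\<^sup>2 \<le> 2 * (norm a)\<^sup>2 + 2 * (norm b)\<^sup>2"
proof -
  have "(norm (a + b))\<^sup>2 \<le> (norm a + norm b)\<^sup>2"
    by (intro power_mono norm_triangle_ineq) simp
  also have "\<dots> \<le> 2 * (norm a)\<^sup>2 + 2 * (norm b)\<^sup>2"
    using sum_squares_bound[of "norm a" "norm b"] by (simp add: power2_sum)
  finally show ?thesis .
qed

lemma L2_geometric_increments_limit:
  fixes f :: "nat \<Rightarrow> 'a \<Rightarrow> 'b::{banach, second_countable_topology}"
  assumes [measurable]: "\<And>k. f k \<in> borel_measurable M"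
    and int: "\<And>k. integrable M (\<lambda>x. (norm (f (Suc k) x - f k x))\<^sup>2)"
    and step: "\<And>k. (\<integral>x. (norm (f (Suc k) x - f k x))\<^sup>2 \<partial>M) \<le> C * (p ^ k) ^ 4"
    and p: "0 < p" "p < 1"
  obtains g where "g \<in> borel_measurable M" "\<And>k. integrable M (\<lambda>x. (norm (f k x - g x))\<^sup>2)"
    "(\<lambda>k. \<integral>x. (norm (f k x - g x))\<^sup>2 \<partial>M) \<longlonglongrightarrow> 0"
proof -
  text \<open>The weights make \<open>S\<close> integrable, while \<open>a k \<le> S\<close> still bounds the increments of \<open>f\<close> at
    almost every point by a geometric sequence.\<close>
  define a where "a k x = (norm (f (Suc k) x - f k x))\<^sup>2 / (p ^ k)\<^sup>2" for k x
  define S where "S x = (\<Sum>k. ennreal (a k x))" for x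
  define T where "T x = enn2real (S x)" for x
  define g where "g x = lim (\<lambda>k. f k x)" for x
  have [measurable]: "a k \<in> borel_measurable M" for k unfolding a_def by measurable
  have [measurable]: "S \<in> borel_measurable M" unfolding S_def by measurable
  have [measurable]: "T \<in> borel_measurable M" unfolding T_def by measurable
  have g_meas[measurable]: "g \<in> borel_measurable M" unfolding g_def by measurable
  have "0 \<le> C" using order_trans[OF _ step[of 0]] by simp
  have "(\<integral>\<^sup>+x. S x \<partial>M) = (\<Sum>k. \<integral>\<^sup>+x. ennreal (a k x) \<partial>M)"
    unfolding S_def by (rule nn_integral_suminf) simp
  also have "\<dots> \<le> (\<Sum>k. ennreal (C * (p\<^sup>2) ^ k))"
  proof (intro suminf_le summableI)
    fix k
    have "(\<integral>\<^sup>+x. ennreal (a k x) \<partial>M) = ennreal (\<integral>x. a k x \<partial>M)"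
      unfolding a_def by (intro nn_integral_eq_integral integrable_divide int) auto
    also have "(\<integral>x. a k x \<partial>M) \<le> C * (p ^ k) ^ 4 / (p ^ k)\<^sup>2"
      using divide_right_mono[OF step, of "(p ^ k)\<^sup>2"] by (simp add: a_def)
    \<comment> \<open>Half of the fourth power cancels the weight and the other half keeps the
      series summable.\<close>
    also have "(p ^ k) ^ 4 = (p ^ k)\<^sup>2 * (p ^ k)\<^sup>2"
      by (simp flip: power_add)
    also have "C * ((p ^ k)\<^sup>2 * (p ^ k)\<^sup>2) / (p ^ k)\<^sup>2 = C * (p\<^sup>2) ^ k"
      using p by (simp add: mult.commute flip: power_mult)
    finally show "(\<integral>\<^sup>+x. ennreal (a k x) \<partial>M) \<le> ennreal (C * (p\<^sup>2) ^ k)"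
      by (simp add: ennreal_leI)
  qed
  also have "\<dots> < \<infinity>"
  proof -
    have "summable (\<lambda>k. C * (p\<^sup>2) ^ k)"
      using p by (intro summable_mult summable_geometric) (auto simp: power_less_one_iff)
    then show ?thesis
      using \<open>0 \<le> C\<close> p by (simp add: suminf_ennreal2)
  qed
  finally have S_fin: "(\<integral>\<^sup>+x. S x \<partial>M) < \<infinity>" .
  then have AE_fin: "AE x in M. S x \<noteq> \<infinity>"
    by (intro nn_integral_noteq_infinite) auto
  have "(\<integral>\<^sup>+x. ennreal (T x) \<partial>M) = (\<integral>\<^sup>+x. S x \<partial>M)"
    by (rule nn_integral_cong_AE) (use AE_fin in eventually_elim, auto simp: T_def less_top)
  then have T_int: "integrable M T"
    using S_fin by (intro integrableI_nonneg) (auto simp: T_def)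
  have AE_bound: "AE x in M. \<forall>m. (norm (f m x - g x))\<^sup>2 \<le> T x * ((p\<^sup>2) ^ m / (1 - p)\<^sup>2)"
    using AE_fin
  proof eventually_elim
    case (elim x)
    have T0: "0 \<le> T x" by (simp add: T_def)
    have "norm (f (Suc k) x - f k x) \<le> sqrt (T x) * p ^ k" for k
    proof -
      have "ennreal (a k x) \<le> S x"
        using sum_le_suminf[of "\<lambda>k. ennreal (a k x)" "{k}"] by (simp add: S_def summableI)
      also have "S x = ennreal (T x)" using elim by (simp add: T_def less_top)
      finally have "a k x \<le> T x" by (simp add: T0)
      then have "(norm (f (Suc k) x - f k x))\<^sup>2 \<le> T x * (p ^ k)\<^sup>2"
        using p by (simp add: a_def divide_le_eq)
      then have "(norm (f (Suc k) x - f k x))\<^sup>2 \<le> (sqrt (T x) * p ^ k)\<^sup>2"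
        using T0 by (simp add: power_mult_distrib)
      then show ?thesis
        by (rule power2_le_imp_le) (use p T0 in auto)
    qed
    then have "norm (f m x - g x) \<le> sqrt (T x) * p ^ m / (1 - p)" for m
      using geometric_increments_limit(2)[of "\<lambda>k. f k x" "sqrt (T x)" p m] p by (simp add: g_def)
    then have "(norm (f m x - g x))\<^sup>2 \<le> (sqrt (T x) * p ^ m / (1 - p))\<^sup>2" for m
      by (intro power_mono) auto
    then show ?case
      using T0 by (simp add: power_mult_distrib power_divide mult.commute flip: power_mult)
  qed
  have g_int: "integrable M (\<lambda>x. (norm (f m x - g x))\<^sup>2)" for m
    by (rule Bochner_Integration.integrable_bound[OF integrable_mult_left[OF T_int, of "(p\<^sup>2) ^ m / (1 - p)\<^sup>2"]])
       (use AE_bound in \<open>auto elim!: eventually_mono simp: abs_mult T_def\<close>)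
  have le: "(\<integral>x. (norm (f m x - g x))\<^sup>2 \<partial>M) \<le> (\<integral>x. T x \<partial>M) * ((p\<^sup>2) ^ m / (1 - p)\<^sup>2)" for m
  proof -
    have "(\<integral>x. (norm (f m x - g x))\<^sup>2 \<partial>M) \<le> (\<integral>x. T x * ((p\<^sup>2) ^ m / (1 - p)\<^sup>2) \<partial>M)"
      by (rule integral_mono_AE[OF g_int integrable_mult_left[OF T_int]])
         (use AE_bound in eventually_elim, auto)
    then show ?thesis by simp
  qed
  have "(\<lambda>m. \<integral>x. (norm (f m x - g x))\<^sup>2 \<partial>M) \<longlonglongrightarrow> 0"
  proof (rule tendsto_sandwich[OF _ _ tendsto_const])
    show "(\<lambda>m. (\<integral>x. T x \<partial>M) * ((p\<^sup>2) ^ m / (1 - p)\<^sup>2)) \<longlonglongrightarrow> 0"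
      using p by (auto intro!: tendsto_eq_intros LIMSEQ_power_zero simp: power_less_one_iff)
  qed (use le in auto)
  then show thesis
    using that g_meas g_int by blast
qed

section \<open>Estimates for the squared L2 norm, and a fixed point theorem\<close>

definition L2_sq :: "(real^'n::finite \<Rightarrow> 'b::euclidean_space) \<Rightarrow> real" where
  "L2_sq f = (\<integral>x. (norm (f x))\<^sup>2 \<partial>lebesgue)"

lemma Lp2_iff:
  "f \<in> Lp 2 \<longleftrightarrow> f \<in> borel_measurable lebesgue \<and> integrable lebesgue (\<lambda>x. (norm (f x))\<^sup>2)"
  by (simp add: Lp_def)

text \<open>Estimates are carried out for squared norms to avoid roots; this is the link to the
  quotient in \<open>ellipticity\<close>.\<close>

lemma Lp_norm_2: "Lp_norm 2 f = sqrt (L2_sq f)"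
  by (simp add: Lp_norm_def L2_sq_def powr_half_sqrt)

lemma L2_sq_nonneg: "0 \<le> L2_sq f"
  by (simp add: L2_sq_def)

text \<open>The codomains may differ because values of the operators are compared with
  Hessians.\<close>

lemma L2_sq_le_scaled:
  fixes f :: "real^'n::finite \<Rightarrow> 'b::euclidean_space" and h :: "real^'n \<Rightarrow> 'c::euclidean_space"
  assumes f: "f \<in> borel_measurable lebesgue" and h: "h \<in> Lp 2"
    and le: "AE x in lebesgue. norm (f x) \<le> c * norm (h x)"
  shows "f \<in> Lp 2" "L2_sq f \<le> c\<^sup>2 * L2_sq h"
proof -
  have int: "integrable lebesgue (\<lambda>x. c\<^sup>2 * (norm (h x))\<^sup>2)"
    using h by (simp add: Lp2_iff)
  have le2: "AE x in lebesgue. (norm (f x))\<^sup>2 \<le> c\<^sup>2 * (norm (h x))\<^sup>2"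
    using le
  proof eventually_elim
    case (elim x)
    then show ?case using power_mono[OF elim, of 2] by (simp add: power_mult_distrib)
  qed
  have int_f: "integrable lebesgue (\<lambda>x. (norm (f x))\<^sup>2)"
    by (rule Bochner_Integration.integrable_bound[OF int]) (use f le2 in \<open>auto elim: eventually_mono\<close>)
  then show "f \<in> Lp 2" using f by (simp add: Lp2_iff)
  show "L2_sq f \<le> c\<^sup>2 * L2_sq h"
    using integral_mono_AE[OF int_f int le2] by (simp add: L2_sq_def)
qed

text \<open>The factor 2 is a crude replacement for the Minkowski inequality, good enough where both
  summands tend to 0.\<close>

lemma Lp2_add:
  fixes f h :: "real^'n::finite \<Rightarrow> 'b::euclidean_space"
  assumes f: "f \<in> Lp 2" and h: "h \<in> Lp 2"
  shows "(\<lambda>x. f x + h x) \<in> Lp 2" "L2_sq (\<lambda>x. f x + h x) \<le> 2 * L2_sq f + 2 * L2_sq h"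
proof -
  have [measurable]: "f \<in> borel_measurable lebesgue" "h \<in> borel_measurable lebesgue"
    using f h by (auto simp: Lp2_iff)
  have int: "integrable lebesgue (\<lambda>x. 2 * (norm (f x))\<^sup>2 + 2 * (norm (h x))\<^sup>2)"
    using f h by (simp add: Lp2_iff)
  have int_add: "integrable lebesgue (\<lambda>x. (norm (f x + h x))\<^sup>2)"
    by (rule Bochner_Integration.integrable_bound[OF int]) (auto simp: norm_add_squared_le)
  then show "(\<lambda>x. f x + h x) \<in> Lp 2" by (simp add: Lp2_iff)
  show "L2_sq (\<lambda>x. f x + h x) \<le> 2 * L2_sq f + 2 * L2_sq h"
    using integral_mono[OF int_add int norm_add_squared_le] f h by (simp add: L2_sq_def Lp2_iff)
qed

lemma Lp2_minus: "f \<in> Lp 2 \<Longrightarrow> (\<lambda>x. - f x) \<in> Lp 2"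
  by (simp add: Lp2_iff)

lemma L2_sq_minus: "L2_sq (\<lambda>x. - f x) = L2_sq f"
  by (simp add: L2_sq_def)

lemma Lp2_diff:
  fixes f h :: "real^'n::finite \<Rightarrow> 'b::euclidean_space"
  assumes f: "f \<in> Lp 2" and h: "h \<in> Lp 2"
  shows "(\<lambda>x. f x - h x) \<in> Lp 2"
  using Lp2_add(1)[OF f Lp2_minus[OF h]] by simp

lemma L2_sq_cong_AE:
  fixes f h :: "real^'n::finite \<Rightarrow> 'b::euclidean_space"
  assumes "f \<in> borel_measurable lebesgue" "AE x in lebesgue. f x = h x"
  shows "L2_sq f = L2_sq h"
proof -
  have "h \<in> borel_measurable lebesgue" by (rule borel_measurable_AE[OF assms])
  then show ?thesis
    unfolding L2_sq_def using assms by (intro integral_cong_AE) auto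
qed

lemma L2_sq_eq_0:
  fixes f :: "real^'n::finite \<Rightarrow> 'b::euclidean_space"
  assumes "f \<in> Lp 2" "L2_sq f \<le> 0"
  shows "AE x in lebesgue. f x = 0"
proof -
  have "L2_sq f = 0" using assms(2) L2_sq_nonneg[of f] by simp
  then have "AE x in lebesgue. (norm (f x))\<^sup>2 = 0"
    using assms(1) by (subst (asm) L2_sq_def, subst (asm) integral_nonneg_eq_0_iff_AE) (auto simp: Lp2_iff)
  then show ?thesis by simp
qed

text \<open>Picard iteration from the zero function. As functions rather than classes are used, the
  limit is fixed only almost everywhere.\<close>

lemma Lp2_contraction_fixed_point:
  fixes \<Phi> :: "(real^'n::finite \<Rightarrow> 'b::euclidean_space) \<Rightarrow> (real^'n \<Rightarrow> 'b)"
  assumes maps: "\<And>f. f \<in> Lp 2 \<Longrightarrow> \<Phi> f \<in> Lp 2"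
    and contr: "\<And>f h. f \<in> Lp 2 \<Longrightarrow> h \<in> Lp 2 \<Longrightarrow>
      L2_sq (\<lambda>x. \<Phi> f x - \<Phi> h x) \<le> r * L2_sq (\<lambda>x. f x - h x)"
    and r: "0 < r" "r < 1"
  obtains f where "f \<in> Lp 2" "ae_eq (\<Phi> f) f"
proof -
  define y where "y k = (\<Phi> ^^ k) (\<lambda>x. 0)" for k
  have y_Suc: "y (Suc k) = \<Phi> (y k)" for k by (simp add: y_def)
  have y_Lp: "y k \<in> Lp 2" for k
    by (induction k) (auto simp: y_Suc maps, simp add: y_def zero_in_Lp)
  \<comment> \<open>The fourth root of \<open>r\<close> matches the decay \<open>(p ^ k) ^ 4\<close>
    required for the increments.\<close>
  define p where "p = sqrt (sqrt r)"
  have p: "0 < p" "p < 1" using r by (auto simp: p_def)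
  have p4: "(p ^ k) ^ 4 = r ^ k" for k
  proof -
    have "p ^ 4 = (p\<^sup>2)\<^sup>2" by (simp flip: power_mult)
    also have "\<dots> = r" using r by (simp add: p_def)
    finally show ?thesis by (metis power_mult mult.commute)
  qed
  have step: "L2_sq (\<lambda>x. y (Suc k) x - y k x) \<le> L2_sq (\<lambda>x. y 1 x - y 0 x) * r ^ k" for k
  proof (induction k)
    case (Suc k)
    have "L2_sq (\<lambda>x. y (Suc (Suc k)) x - y (Suc k) x) \<le> r * L2_sq (\<lambda>x. y (Suc k) x - y k x)"
      using contr[OF y_Lp y_Lp, of "Suc k" k] by (simp add: y_Suc)
    also have "\<dots> \<le> r * (L2_sq (\<lambda>x. y 1 x - y 0 x) * r ^ k)"
      using Suc r by (intro mult_left_mono) auto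
    finally show ?case by (simp add: mult.left_commute mult.commute)
  qed simp
  obtain f where f: "f \<in> borel_measurable lebesgue"
    "\<And>k. integrable lebesgue (\<lambda>x. (norm (y k x - f x))\<^sup>2)"
    "(\<lambda>k. \<integral>x. (norm (y k x - f x))\<^sup>2 \<partial>lebesgue) \<longlonglongrightarrow> 0"
  proof (rule L2_geometric_increments_limit[of y lebesgue "L2_sq (\<lambda>x. y 1 x - y 0 x)" p])
    show "y k \<in> borel_measurable lebesgue" for k using y_Lp by (simp add: Lp2_iff)
    show "integrable lebesgue (\<lambda>x. (norm (y (Suc k) x - y k x))\<^sup>2)" for k
      using Lp2_diff[OF y_Lp y_Lp, of "Suc k" k] by (simp add: Lp2_iff)
    show "(\<integral>x. (norm (y (Suc k) x - y k x))\<^sup>2 \<partial>lebesgue) \<le> L2_sq (\<lambda>x. y 1 x - y 0 x) * (p ^ k) ^ 4" for k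
      using step[of k] by (simp add: L2_sq_def p4)
  qed (use p in auto)
  have y_meas: "y k \<in> borel_measurable lebesgue" for k using y_Lp by (simp add: Lp2_iff)
  have diff: "(\<lambda>x. y k x - f x) \<in> Lp 2" for k
    using f(1,2) y_meas by (simp add: Lp2_iff)
  have f_Lp: "f \<in> Lp 2"
    using Lp2_diff[OF y_Lp diff, of 0 0] by simp
  have conv: "(\<lambda>k. L2_sq (\<lambda>x. y k x - f x)) \<longlonglongrightarrow> 0"
    using f(3) by (simp add: L2_sq_def)
  \<comment> \<open>The iterate \<open>y (Suc k)\<close>, which is \<open>\<Phi> (y k)\<close>, is
    inserted between \<open>\<Phi> f\<close> and \<open>f\<close>; both distances tend to 0.\<close>
  have le: "L2_sq (\<lambda>x. \<Phi> f x - f x) \<le> 2 * (r * L2_sq (\<lambda>x. y k x - f x)) + 2 * L2_sq (\<lambda>x. y (Suc k) x - f x)" for k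
  proof -
    have "L2_sq (\<lambda>x. (\<Phi> f x - y (Suc k) x) + (y (Suc k) x - f x))
        \<le> 2 * L2_sq (\<lambda>x. \<Phi> f x - y (Suc k) x) + 2 * L2_sq (\<lambda>x. y (Suc k) x - f x)"
      by (intro Lp2_add Lp2_diff maps f_Lp y_Lp)
    moreover have "L2_sq (\<lambda>x. \<Phi> f x - y (Suc k) x) \<le> r * L2_sq (\<lambda>x. f x - y k x)"
      using contr[OF f_Lp y_Lp] by (simp add: y_Suc)
    moreover have "L2_sq (\<lambda>x. f x - y k x) = L2_sq (\<lambda>x. y k x - f x)"
      using L2_sq_minus[of "\<lambda>x. y k x - f x"] by simp
    ultimately show ?thesis by simp
  qed
  have "(\<lambda>k. 2 * (r * L2_sq (\<lambda>x. y k x - f x)) + 2 * L2_sq (\<lambda>x. y (Suc k) x - f x)) \<longlonglongrightarrow> 2 * (r * 0) + 2 * 0"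
    by (intro tendsto_intros conv LIMSEQ_Suc[OF conv])
  then have "L2_sq (\<lambda>x. \<Phi> f x - f x) \<le> 0"
    using le by (intro LIMSEQ_le_const) auto
  then have "AE x in lebesgue. \<Phi> f x - f x = 0"
    by (intro L2_sq_eq_0 Lp2_diff maps f_Lp)
  then show thesis
    using that[OF f_Lp] by (simp add: ae_eq_def)
qed

section \<open>Unique solvability for an operator near a bijective one\<close>

theorem theorem17:
  fixes F G :: "real^'n::finite \<Rightarrow> ('N::finite, 'n) array3 \<Rightarrow> real^'N"
  assumes "CARD('n) \<ge> 5" and "CARD('N) \<ge> 2"
    and "caratheodory F" and "caratheodory G"
    and "bij_ae (hess_op F) W22star (Lp 2)"
    and "ellipticity F > 0"
    and "AE x in lebesgue. G x 0 = 0"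
    and "near_const F G < ellipticity F"
  shows "\<forall>g \<in> Lp 2. \<exists>u \<in> W22star. ae_eq (hess_op G u) g \<and>
           (\<forall>v \<in> W22star. ae_eq (hess_op G v) g \<longrightarrow> ae_eq v u)"
proof
  fix g :: "real^'n \<Rightarrow> real^'N" assume g: "g \<in> Lp 2"
  note bij = assms(5)[unfolded bij_ae_def]
  have F_Lp: "hess_op F u \<in> Lp 2" if "u \<in> W22star" for u
    using bij that by blast
  \<comment> \<open>The strict gap leaves room for two real constants \<open>k < \<nu>\<close>, and
    the maximum with 0 makes both positive.\<close>
  have "max 0 (near_const F G) < ellipticity F"
    using assms(6,8) by simp
  then obtain k where k: "max 0 (near_const F G) < ereal k" "ereal k < ellipticity F"
    by (metis ereal_dense2)
  then obtain \<nu> where \<nu>: "ereal k < ereal \<nu>" "ereal \<nu> < ellipticity F"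
    by (metis ereal_dense2)
  from k \<nu> have k0: "0 < k" and k\<nu>: "k < \<nu>" by auto
  have near: "AE x in lebesgue. \<forall>X\<in>sym_arrays. \<forall>Y\<in>sym_arrays.
      norm ((F x Y - F x X) - (G x Y - G x X)) \<le> k * norm (Y - X)"
    using esssup_AE[of "\<lambda>x. SUP (X, Y) \<in> {(X, Y). X \<in> sym_arrays \<and> Y \<in> sym_arrays \<and> X \<noteq> Y}.
         ereal (norm (((F x Y - F x X) - (G x Y - G x X)) /\<^sub>R norm (Y - X)))" lebesgue]
  proof eventually_elim
    case (elim x)
    show ?case
    proof (intro ballI)
      fix X Y :: "('N, 'n) array3"
      assume XY: "X \<in> sym_arrays" "Y \<in> sym_arrays"
      show "norm ((F x Y - F x X) - (G x Y - G x X)) \<le> k * norm (Y - X)"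
      proof (cases "X = Y")
        case False
        have "ereal (norm (((F x Y - F x X) - (G x Y - G x X)) /\<^sub>R norm (Y - X))) \<le> near_const F G"
          unfolding near_const_def
          by (rule order_trans[OF _ elim]) (rule SUP_upper2[of "(X, Y)"], use XY False in auto)
        also have "\<dots> \<le> ereal k" using k(1) by (simp add: less_imp_le)
        finally have "inverse (norm (Y - X)) * norm ((F x Y - F x X) - (G x Y - G x X)) \<le> k"
          by (simp only: ereal_less_eq norm_scaleR abs_inverse abs_norm_cancel)
        then show ?thesis
          using False by (simp add: pos_divide_le_eq inverse_eq_divide)
      qed simp
    qed
  qed
  have ell: "\<nu>\<^sup>2 * L2_sq (\<lambda>x. weak_hessian w x - weak_hessian v x)
      \<le> L2_sq (\<lambda>x. hess_op F w x - hess_op F v x)"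
    if "v \<in> W22star" "w \<in> W22star" "\<not> ae_eq v w" for v w
  proof -
    let ?a = "L2_sq (\<lambda>x. hess_op F w x - hess_op F v x)"
    let ?b = "L2_sq (\<lambda>x. weak_hessian w x - weak_hessian v x)"
    have "ellipticity F \<le> ereal (sqrt ?a / sqrt ?b)"
      unfolding ellipticity_def Lp_norm_2 by (rule INF_lower2[of "(v, w)"]) (use that in auto)
    from less_le_trans[OF \<nu>(2) this] have "\<nu> < sqrt ?a / sqrt ?b"
      by simp
    \<comment> \<open>Division by 0 gives 0, so a vanishing \<open>?b\<close> would contradict
      \<open>\<nu> > 0\<close>; otherwise the denominator is cleared.\<close>
    then have "\<nu> * sqrt ?b \<le> sqrt ?a"
      using L2_sq_nonneg[of "\<lambda>x. weak_hessian w x - weak_hessian v x"] k0 k\<nu>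
      by (cases "?b = 0") (auto simp: field_simps L2_sq_nonneg)
    then have "(\<nu> * sqrt ?b)\<^sup>2 \<le> (sqrt ?a)\<^sup>2"
      using k0 k\<nu> by (intro power_mono) (auto simp: L2_sq_nonneg)
    then show ?thesis by (simp add: power_mult_distrib L2_sq_nonneg)
  qed
  have G_meas: "hess_op G u \<in> borel_measurable lebesgue" if "u \<in> W22star" for u
    unfolding hess_op_def using weak_hessian_W22star[OF that]
    by (intro caratheodory_compose_measurable assms) (auto simp: Lp2_iff)
  have nearness: "(\<lambda>x. (hess_op F w x - hess_op F v x) - (hess_op G w x - hess_op G v x)) \<in> Lp 2"
      "L2_sq (\<lambda>x. (hess_op F w x - hess_op F v x) - (hess_op G w x - hess_op G v x))
        \<le> k\<^sup>2 * L2_sq (\<lambda>x. weak_hessian w x - weak_hessian v x)"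
    if v: "v \<in> W22star" and w: "w \<in> W22star" for v w
  proof -
    have meas: "(\<lambda>x. (hess_op F w x - hess_op F v x) - (hess_op G w x - hess_op G v x)) \<in> borel_measurable lebesgue"
      using F_Lp[OF v] F_Lp[OF w] G_meas[OF v] G_meas[OF w] by (auto simp: Lp2_iff)
    have D: "(\<lambda>x. weak_hessian w x - weak_hessian v x) \<in> Lp 2"
      using v w by (intro Lp2_diff weak_hessian_W22star)
    \<comment> \<open>The pointwise bound \<open>near\<close> applies because the chosen Hessians
      are symmetric almost everywhere.\<close>
    have le: "AE x in lebesgue. norm ((hess_op F w x - hess_op F v x) - (hess_op G w x - hess_op G v x))
        \<le> k * norm (weak_hessian w x - weak_hessian v x)"
      using near weak_hessian_W22star(2)[OF v] weak_hessian_W22star(2)[OF w]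
      by eventually_elim (simp add: hess_op_def)
    from L2_sq_le_scaled[OF meas D le]
    show "(\<lambda>x. (hess_op F w x - hess_op F v x) - (hess_op G w x - hess_op G v x)) \<in> Lp 2"
      "L2_sq (\<lambda>x. (hess_op F w x - hess_op F v x) - (hess_op G w x - hess_op G v x))
        \<le> k\<^sup>2 * L2_sq (\<lambda>x. weak_hessian w x - weak_hessian v x)" .
  qed
  \<comment> \<open>The ratio is squared because the estimates concern squared norms.\<close>
  define r where "r = (k / \<nu>)\<^sup>2"
  have r: "0 < r" "r < 1"
    using k0 k\<nu> by (auto simp: r_def power_less_one_iff)
  have contr: "L2_sq (\<lambda>x. (hess_op F w x - hess_op F v x) - (hess_op G w x - hess_op G v x))
      \<le> r * L2_sq (\<lambda>x. hess_op F w x - hess_op F v x)"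
    if v: "v \<in> W22star" and w: "w \<in> W22star" and ne: "\<not> ae_eq v w" for v w
  proof -
    have "k\<^sup>2 * L2_sq (\<lambda>x. weak_hessian w x - weak_hessian v x)
        = r * (\<nu>\<^sup>2 * L2_sq (\<lambda>x. weak_hessian w x - weak_hessian v x))"
      using k0 k\<nu> by (simp add: r_def power_divide)
    also have "\<dots> \<le> r * L2_sq (\<lambda>x. hess_op F w x - hess_op F v x)"
      using ell[OF v w ne] r by (intro mult_left_mono) auto
    finally show ?thesis using nearness(2)[OF v w] by simp
  qed
  have G_zero: "AE x in lebesgue. hess_op G (\<lambda>x. 0) x = 0"
    using weak_hessian_zero[where 'n = 'n and 'N = 'N] assms(7)
    by eventually_elim (simp add: hess_op_def)
  have G_Lp: "hess_op G u \<in> Lp 2" if u: "u \<in> W22star" for u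
  proof -
    let ?F = "\<lambda>x. hess_op F u x - hess_op F (\<lambda>x. 0) x"
    \<comment> \<open>This function is G[u] - G[0], written as a difference of two members of L2;
      here G[0] vanishes almost everywhere.\<close>
    have "(\<lambda>x. ?F x - (?F x - (hess_op G u x - hess_op G (\<lambda>x. 0) x))) \<in> Lp 2"
      by (intro Lp2_diff nearness(1) F_Lp u zero_in_W22star)
    then show ?thesis
      by (rule Lp_AE_cong) (use G_zero in eventually_elim, simp)
  qed
  text \<open>Choosing by \<open>SOME\<close> makes \<open>S\<close> constant on almost-everywhere classes, so it need not be shown that
    \<open>hess_op G\<close> respects \<open>ae_eq\<close>.\<close>
  define S where "S f = (SOME u. u \<in> W22star \<and> ae_eq (hess_op F u) f)" for f
  have S: "S f \<in> W22star" "ae_eq (hess_op F (S f)) f" if "f \<in> Lp 2" for f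
  proof -
    have "\<exists>u. u \<in> W22star \<and> ae_eq (hess_op F u) f" using bij that by blast
    from someI_ex[OF this] show "S f \<in> W22star" "ae_eq (hess_op F (S f)) f"
      unfolding S_def by auto
  qed
  have S_cong: "S f = S h" if "ae_eq f h" for f h
  proof -
    have "ae_eq (hess_op F u) f \<longleftrightarrow> ae_eq (hess_op F u) h" for u
      using that unfolding ae_eq_def by (auto elim: eventually_elim2)
    then show ?thesis by (simp add: S_def)
  qed
  \<comment> \<open>Since F[S f] = f almost everywhere, the equation \<open>\<Phi> f = f\<close>
    says precisely that G[S f] = g.\<close>
  define \<Phi> where "\<Phi> f = (\<lambda>x. hess_op F (S f) x - hess_op G (S f) x + g x)" for f
  have "\<Phi> f \<in> Lp 2" if "f \<in> Lp 2" for f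
    unfolding \<Phi>_def by (intro Lp2_add Lp2_diff F_Lp G_Lp S g that)
  moreover have "L2_sq (\<lambda>x. \<Phi> f x - \<Phi> h x) \<le> r * L2_sq (\<lambda>x. f x - h x)"
    if f: "f \<in> Lp 2" and h: "h \<in> Lp 2" for f h
  proof (cases "ae_eq f h")
    case True
    then have "L2_sq (\<lambda>x. \<Phi> f x - \<Phi> h x) = 0"
      by (simp add: \<Phi>_def S_cong[OF True] L2_sq_def)
    then show ?thesis using r by (simp add: L2_sq_nonneg)
  next
    case False
    \<comment> \<open>Distinct classes of data have distinct preimages, so the estimate
      \<open>contr\<close> is available.\<close>
    have "ae_eq f h" if "ae_eq (hess_op F (S h)) (hess_op F (S f))"
      using that S(2)[OF f] S(2)[OF h] unfolding ae_eq_def by eventually_elim simp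
    with False have "\<not> ae_eq (S h) (S f)"
      using bij S(1)[OF f] S(1)[OF h] by blast
    then have "L2_sq (\<lambda>x. \<Phi> f x - \<Phi> h x)
        \<le> r * L2_sq (\<lambda>x. hess_op F (S f) x - hess_op F (S h) x)"
      using contr[OF S(1)[OF h] S(1)[OF f]] by (simp add: \<Phi>_def algebra_simps)
    also have "L2_sq (\<lambda>x. hess_op F (S f) x - hess_op F (S h) x) = L2_sq (\<lambda>x. f x - h x)"
    proof (rule L2_sq_cong_AE)
      show "(\<lambda>x. hess_op F (S f) x - hess_op F (S h) x) \<in> borel_measurable lebesgue"
        using F_Lp[OF S(1)[OF f]] F_Lp[OF S(1)[OF h]] by (auto simp: Lp2_iff)
      show "AE x in lebesgue. hess_op F (S f) x - hess_op F (S h) x = f x - h x"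
        using S(2)[OF f] S(2)[OF h] unfolding ae_eq_def by eventually_elim simp
    qed
    finally show ?thesis .
  qed
  ultimately obtain f where f: "f \<in> Lp 2" "ae_eq (\<Phi> f) f"
    using Lp2_contraction_fixed_point[of \<Phi> r] r by blast
  have sol: "ae_eq (hess_op G (S f)) g"
    using f(2) S(2)[OF f(1)] unfolding ae_eq_def
    by eventually_elim (simp add: \<Phi>_def)
  have "ae_eq v (S f)" if v: "v \<in> W22star" and Gv: "ae_eq (hess_op G v) g" for v
  proof (rule ccontr)
    assume ne: "\<not> ae_eq v (S f)"
    let ?d = "\<lambda>x. hess_op F (S f) x - hess_op F v x"
    have d: "?d \<in> Lp 2" by (intro Lp2_diff F_Lp S f v)
    \<comment> \<open>For two solutions the difference of the G terms vanishes, so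
      \<open>contr\<close> bounds \<open>L2_sq ?d\<close> by \<open>r\<close> times itself. Hence
      \<open>?d\<close> is zero and injectivity of F identifies the solutions.\<close>
    have "L2_sq ?d = L2_sq (\<lambda>x. ?d x - (hess_op G (S f) x - hess_op G v x))"
    proof (rule L2_sq_cong_AE)
      show "AE x in lebesgue. ?d x = ?d x - (hess_op G (S f) x - hess_op G v x)"
        using Gv sol unfolding ae_eq_def by eventually_elim simp
    qed (use d in \<open>simp add: Lp2_iff\<close>)
    also have "\<dots> \<le> r * L2_sq ?d"
      by (rule contr[OF v S(1)[OF f(1)] ne])
    finally have "(1 - r) * L2_sq ?d \<le> 0" by (simp add: algebra_simps)
    then have "L2_sq ?d \<le> 0" using r by (simp add: mult_le_0_iff)
    then have "ae_eq (hess_op F v) (hess_op F (S f))"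
      using L2_sq_eq_0[OF d] unfolding ae_eq_def by (auto elim: eventually_mono)
    then show False using ne bij v S(1)[OF f(1)] by blast
  qed
  with sol S(1)[OF f(1)]
  show "\<exists>u\<in>W22star. ae_eq (hess_op G u) g \<and> (\<forall>v\<in>W22star. ae_eq (hess_op G v) g \<longrightarrow> ae_eq v u)"
    by blast
qed

end
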